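(* For every non-negative integer $r$, the $r$-covering map $\Gamma\mapsto\Gamma^{(r)}$ from the set $\mathcal{VS}$ of virtual strings to itself is surjective. Moreover, if $r\neq 1$, then for every virtual string $\Gamma\in\mathcal{VS}$ there are infinitely many virtual strings $\Lambda\in\mathcal{VS}$ with $\Lambda^{(r)}=\Gamma$.
   Context: Nanowords. A Gauss word is a finite word (possibly empty) in which each letter appears exactly twice or not at all. A nanoword is a Gauss word together with a map $X\mapsto|X|\in\{a,b\}$ from its letters to $\{a,b\}$ ($|X|$ is the type of $X$). The rank of a nanoword is its number of distinct letters. An isomorphism of nanowords is a type-preserving relabelling of letters which carries the $k$th letter of one word to the $k$th letter of the other for all $k$. Two nanowords are homotopic if related by a finite sequence of isomorphisms and the following moves and their inverses ($x,y,z,t$ are arbitrary sequences of letters such that both sides are Gauss words, types of letters being unchanged unless stated): shift: $AxAy\leftrightarrow xA'yA'$ where $|A'|\neq|A|$; H1: $xAAy\leftrightarrow xy$; H2: $xAByBAz\leftrightarrow xyz$ where $|A|\ne|B|$; H3: $xAByACzBCt\leftrightarrow xBAyCAzCBt$ where $|A|=|B|=|C|$. Virtual strings. A virtual string is (equivalently to its definition via planar diagrams with real and virtual crossings modulo flattened Reidemeister-type moves) a homotopy class of nanowords; $\mathcal{VS}$ is the set of all of them. A nanoword represents its class. Linking. Let $\alpha$ be a nanoword. Distinct letters $A,B$ are linked if they alternate in $\alpha$. Set $l(A,B)=0$ if $A=B$ or $A,B$ are not linked. If they occur in the order $\dots A\dots B\dots A\dots B\dots$, set $l(A,B)=1$ if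 $|A|=|B|$ and $-1$ otherwise; if in the order $\dots B\dots A\dots B\dots A\dots$, set $l(A,B)=-1$ if $|A|=|B|$ and $1$ otherwise. Put $n(X)=\sum_{Y\in\alpha}l(X,Y)$, the sum over all letters $Y$ of $\alpha$. Coverings. For a non-negative integer $r$, the $r$-covering $\alpha^{(r)}$ of $\alpha$ is obtained by deleting from $\alpha$ (both occurrences of) every letter $X$ for which $n(X)$ (computed in $\alpha$) is not divisible by $r$ (for $r=0$: delete every $X$ with $n(X)\neq0$). It is known that homotopic nanowords have homotopic $r$-coverings, so for a virtual string $\Gamma$ represented by $\alpha$, $\Gamma^{(r)}$ is defined as the virtual string represented by $\alpha^{(r)}$. *)

theory Defs
  imports Main "HOL-Library.Sublist"
begin

datatype letter_type = Type_a | Type_b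

text \<open>
  Letters are drawn from the infinite alphabet \<open>nat\<close>. The type map is a total function, but only its
  values on the letters occurring in the word carry meaning: two type maps which agree on these
  letters give isomorphic nanowords.
\<close>

type_synonym typed_word = "nat list \<times> (nat \<Rightarrow> letter_type)"

definition gauss_word :: "nat list \<Rightarrow> bool" where
  "gauss_word w \<longleftrightarrow> (\<forall>X. count_list w X = 0 \<or> count_list w X = 2)"

definition nanowords :: "typed_word set" where
  "nanowords = {(w, \<tau>). gauss_word w}"

definition nanoword_iso :: "typed_word \<Rightarrow> typed_word \<Rightarrow> bool" where
  "nanoword_iso \<alpha> \<beta> \<longleftrightarrow>
     (\<exists>f. bij_betw f (set (fst \<alpha>)) (set (fst \<beta>)) \<and> fst \<beta> = map f (fst \<alpha>) \<and>
          (\<forall>X\<in>set (fst \<alpha>). snd \<beta> (f X) = snd \<alpha> X))"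

text \<open>
  The requirement that both sides are Gauss words is imposed in \<open>homotopy_step\<close>; it forces the
  letters \<open>A\<close>, \<open>A'\<close>, \<open>B\<close>, \<open>C\<close> of a move to be distinct from one another (apart from \<open>A\<close> and \<open>A'\<close>) and
  from the letters of the remaining segments. In \<open>shift\<close>, \<open>A'\<close> may be a new letter or \<open>A\<close> itself
  with its type switched.
\<close>

inductive nanoword_move :: "typed_word \<Rightarrow> typed_word \<Rightarrow> bool" where
  shift: "\<tau>' A' \<noteq> \<tau> A \<Longrightarrow> \<forall>X\<in>set x \<union> set y. \<tau>' X = \<tau> X \<Longrightarrow>
    nanoword_move ([A] @ x @ [A] @ y, \<tau>) (x @ [A'] @ y @ [A'], \<tau>')"
| H1: "nanoword_move (x @ [A, A] @ y, \<tau>) (x @ y, \<tau>)"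
| H2: "\<tau> A \<noteq> \<tau> B \<Longrightarrow>
    nanoword_move (x @ [A, B] @ y @ [B, A] @ z, \<tau>) (x @ y @ z, \<tau>)"
| H3: "\<tau> A = \<tau> B \<Longrightarrow> \<tau> B = \<tau> C \<Longrightarrow>
    nanoword_move (x @ [A, B] @ y @ [A, C] @ z @ [B, C] @ t, \<tau>)
                  (x @ [B, A] @ y @ [C, A] @ z @ [C, B] @ t, \<tau>)"

definition homotopy_step :: "typed_word \<Rightarrow> typed_word \<Rightarrow> bool" where
  "homotopy_step \<alpha> \<beta> \<longleftrightarrow>
     \<alpha> \<in> nanowords \<and> \<beta> \<in> nanowords \<and> (nanoword_iso \<alpha> \<beta> \<or> nanoword_move \<alpha> \<beta>)"

definition homotopy :: "(typed_word \<times> typed_word) set" where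
  "homotopy = {(\<alpha>, \<beta>). \<alpha> \<in> nanowords \<and> \<beta> \<in> nanowords \<and> equivclp homotopy_step \<alpha> \<beta>}"

lemma equiv_homotopy: "equiv nanowords homotopy"
  by (rule equivI)
     (auto simp: homotopy_def refl_on_def intro!: symI transI intro: equivclp_sym equivclp_trans)

definition virtual_strings :: "typed_word set set" where
  "virtual_strings = nanowords // homotopy"

definition linked :: "typed_word \<Rightarrow> nat \<Rightarrow> nat \<Rightarrow> bool" where
  "linked \<alpha> A B \<longleftrightarrow>
     A \<noteq> B \<and> (subseq [A, B, A, B] (fst \<alpha>) \<or> subseq [B, A, B, A] (fst \<alpha>))"

definition linking :: "typed_word \<Rightarrow> nat \<Rightarrow> nat \<Rightarrow> int" where
  "linking \<alpha> A B =
     (if \<not> linked \<alpha> A B then 0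
      else if subseq [A, B, A, B] (fst \<alpha>) then (if snd \<alpha> A = snd \<alpha> B then 1 else -1)
      else (if snd \<alpha> A = snd \<alpha> B then -1 else 1))"

definition letter_index :: "typed_word \<Rightarrow> nat \<Rightarrow> int" where
  "letter_index \<alpha> X = (\<Sum>Y\<in>set (fst \<alpha>). linking \<alpha> X Y)"

text \<open>For \<open>r = 0\<close> the divisibility condition says that the index vanishes.\<close>

definition covering :: "nat \<Rightarrow> typed_word \<Rightarrow> typed_word" where
  "covering r \<alpha> = (filter (\<lambda>X. int r dvd letter_index \<alpha> X) (fst \<alpha>), snd \<alpha>)"

text \<open>
  The usual lifting of a function to equivalence classes: since coverings of homotopic nanowords
  are homotopic, all sets in this union are the same homotopy class.
\<close>

definition vs_covering :: "nat \<Rightarrow> typed_word set \<Rightarrow> typed_word set" where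
  "vs_covering r \<Gamma> = (\<Union>\<alpha>\<in>\<Gamma>. homotopy `` {covering r \<alpha>})"

end

theory Submission imports Defs "HOL-Library.Infinite_Set" begin

text \<open>
  Inserting a fresh letter \<open>P\<close> on both sides of one occurrence of \<open>A\<close> links \<open>P\<close> with \<open>A\<close> alone, so it
  changes the index of \<open>A\<close> by \<open>\<plusminus>1\<close> (the sign being governed by the type of \<open>P\<close>), gives \<open>P\<close> the
  opposite index and affects no other letter. Repeating this, the indices of the letters of a
  nanoword can be prescribed arbitrarily at the cost of new letters of index \<open>\<plusminus>1\<close>, which a covering
  with \<open>r \<noteq> 1\<close> deletes. Given \<open>\<alpha>\<close> and \<open>k \<ge> 2\<close> not divisible by \<open>r\<close>, append \<open>XX\<close> to \<open>\<alpha>\<close> and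
  prescribe index \<open>0\<close> for the letters of \<open>\<alpha>\<close> and \<open>k\<close> for \<open>X\<close>: the result covers \<open>\<alpha>\<close>. Different \<open>k\<close>
  are told apart by the homotopy invariant ``number of letters of index \<open>m\<close> minus number of letters
  of index \<open>-m\<close>'', the coefficients of Turaev's \<open>u\<close>-polynomial.
\<close>

section \<open>Linking numbers through arcs\<close>

text \<open>Signs in place of types turn the case distinction on equal types in
  \<open>linking\<close> into a product.\<close>

definition type_sign :: "letter_type \<Rightarrow> int" where
  "type_sign c = (if c = Type_a then 1 else -1)"

lemma type_sign_mult: "type_sign c * type_sign d = (if c = d then 1 else -1)"
  by (cases c; cases d) (simp_all add: type_sign_def)

lemma type_sign_mult_self [simp]: "type_sign c * type_sign c = 1"
  by (simp add: type_sign_mult)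

lemma type_sign_neq: "c \<noteq> d \<Longrightarrow> type_sign c = - type_sign d"
  by (cases c; cases d) (simp_all add: type_sign_def)

text \<open>
  The letters met exactly once along the prefix \<open>p\<close>, counted with signs. For a word \<open>xAyAz\<close> the index
  of \<open>A\<close> is, up to the sign of \<open>A\<close>, the difference of the heights of \<open>xy\<close> and \<open>x\<close>; using parities
  makes the formula hold without excluding letters that do not link \<open>A\<close>.
\<close>

definition height :: "(nat \<Rightarrow> letter_type) \<Rightarrow> nat list \<Rightarrow> int" where
  "height \<tau> p = (\<Sum>Y\<in>set p. type_sign (\<tau> Y) * of_bool (odd (count_list p Y)))"

lemma height_superset:
  assumes "finite S" "set p \<subseteq> S"
  shows "height \<tau> p = (\<Sum>Y\<in>S. type_sign (\<tau> Y) * of_bool (odd (count_list p Y)))"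
  unfolding height_def using assms
  by (intro sum.mono_neutral_left) (auto simp: count_list_0_iff)

lemma height_Nil [simp]: "height \<tau> [] = 0"
  by (simp add: height_def)

text \<open>Only the parity of \<open>B\<close> flips, so its term appears or disappears. In
  particular a letter inserted twice leaves the height unchanged.\<close>

lemma height_insert:
  "height \<tau> (p @ B # q) =
     height \<tau> (p @ q) + type_sign (\<tau> B) * (if odd (count_list (p @ q) B) then -1 else 1)"
proof -
  let ?S = "set (p @ B # q)"
  have "height \<tau> (p @ B # q) = (\<Sum>Y\<in>?S. type_sign (\<tau> Y) * of_bool (odd (count_list (p @ B # q) Y)))"
    by (rule height_superset) auto
  also have "\<dots> = type_sign (\<tau> B) * of_bool (odd (count_list (p @ B # q) B)) +
      (\<Sum>Y\<in>?S - {B}. type_sign (\<tau> Y) * of_bool (odd (count_list (p @ B # q) Y)))"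
    by (rule sum.remove) auto
  also have "(\<Sum>Y\<in>?S - {B}. type_sign (\<tau> Y) * of_bool (odd (count_list (p @ B # q) Y))) =
      (\<Sum>Y\<in>?S - {B}. type_sign (\<tau> Y) * of_bool (odd (count_list (p @ q) Y)))"
    by (rule sum.cong) auto
  also have "\<dots> = height \<tau> (p @ q) - type_sign (\<tau> B) * of_bool (odd (count_list (p @ q) B))"
  proof -
    have "height \<tau> (p @ q) = (\<Sum>Y\<in>?S. type_sign (\<tau> Y) * of_bool (odd (count_list (p @ q) Y)))"
      by (rule height_superset) auto
    also have "\<dots> = type_sign (\<tau> B) * of_bool (odd (count_list (p @ q) B)) +
        (\<Sum>Y\<in>?S - {B}. type_sign (\<tau> Y) * of_bool (odd (count_list (p @ q) Y)))"
      by (rule sum.remove) auto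
    finally show ?thesis by linarith
  qed
  finally show ?thesis by auto
qed

lemma height_gauss_word: "gauss_word w \<Longrightarrow> height \<tau> w = 0"
  unfolding height_def gauss_word_def
  by (intro sum.neutral ballI) (metis even_zero even_numeral mult_zero_right of_bool_eq(1))

lemma height_cong: "(\<And>Y. Y \<in> set p \<Longrightarrow> \<tau> Y = \<tau>' Y) \<Longrightarrow> height \<tau> p = height \<tau>' p"
  unfolding height_def by (intro sum.cong) auto

section \<open>Gauss words cut at the two occurrences of a letter\<close>

lemma gauss_word_arc:
  assumes "gauss_word (x @ A # y @ A # z)"
  shows "A \<notin> set x" "A \<notin> set y" "A \<notin> set z"
  using assms[unfolded gauss_word_def, rule_format, of A] by (auto simp: count_list_0_iff)

lemma gauss_word_filter: "gauss_word w \<Longrightarrow> gauss_word (filter P w)"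
proof -
  have "count_list (filter P w) X = (if P X then count_list w X else 0)" for X
    by (induction w) auto
  then show "gauss_word w \<Longrightarrow> gauss_word (filter P w)"
    by (auto simp: gauss_word_def)
qed

lemma gauss_word_obtain_arc:
  assumes "gauss_word w" "A \<in> set w"
  obtains x y z where "w = x @ A # y @ A # z"
proof -
  obtain x u where w: "w = x @ A # u" "A \<notin> set x"
    using split_list_first[OF assms(2)] by blast
  have "count_list w A = 2"
    using assms by (auto simp: gauss_word_def count_list_0_iff)
  with w have "count_list u A = 1" by simp
  then have "A \<in> set u" by (metis count_notin zero_neq_one)
  then obtain y z where "u = y @ A # z" using split_list by metis
  with w that show ?thesis by blast
qed

lemma subseq_notin_prefix: "A \<notin> set x \<Longrightarrow> subseq (A # l) (x @ r) \<longleftrightarrow> subseq (A # l) r"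
  by (induction x) auto

text \<open>Both occurrences of \<open>A\<close> are displayed, so each \<open>A\<close> of the
  pattern can only match one of these two. What remains is to ask in which segments \<open>Y\<close>
  lies.\<close>

lemma subseq_arc_iff:
  assumes "A \<notin> set x" "A \<notin> set y" "A \<notin> set z" "A \<noteq> Y"
  shows "subseq [A, Y, A, Y] (x @ A # y @ A # z) \<longleftrightarrow> Y \<in> set y \<and> Y \<in> set z"
    and "subseq [Y, A, Y, A] (x @ A # y @ A # z) \<longleftrightarrow> Y \<in> set x \<and> Y \<in> set y"
proof -
  have no: "\<not> subseq (Y # A # l) z" for l
    using assms(3) by (auto elim: list_emb_set[where x = A])
  \<comment> \<open>Behind the first \<open>A\<close> only one more \<open>A\<close> is left, so
    \<open>Y\<close> must come before it and the rest of the pattern must fit into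
    \<open>z\<close>.\<close>
  have YA: "subseq (Y # A # l) (y @ A # z) \<longleftrightarrow> Y \<in> set y \<and> subseq l z" for l
  proof (cases "Y \<in> set y")
    case True
    then obtain p q where y: "y = p @ Y # q" "Y \<notin> set p" using split_list_first by metis
    then have "A \<notin> set q" using assms by auto
    then show ?thesis using y assms by (simp add: subseq_notin_prefix)
  next
    case False
    then show ?thesis using assms(4) no by (simp add: subseq_notin_prefix)
  qed
  show "subseq [A, Y, A, Y] (x @ A # y @ A # z) \<longleftrightarrow> Y \<in> set y \<and> Y \<in> set z"
    using assms by (simp add: subseq_notin_prefix YA subseq_singleton_left)
  show "subseq [Y, A, Y, A] (x @ A # y @ A # z) \<longleftrightarrow> Y \<in> set x \<and> Y \<in> set y"
  proof (cases "Y \<in> set x")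
    case True
    then obtain p q where x: "x = p @ Y # q" "Y \<notin> set p" using split_list_first by metis
    then have "A \<notin> set q" using assms by auto
    then show ?thesis using x assms by (simp add: subseq_notin_prefix YA)
  next
    \<comment> \<open>Without a \<open>Y\<close> in \<open>x\<close> the pattern would have to start
      in \<open>y\<close>, which pushes \<open>[Y, A]\<close> into \<open>z\<close>, where there is
      no \<open>A\<close>.\<close>
    case False
    have "\<not> subseq [Y, A] z" using no .
    then show ?thesis using False assms YA[of "[Y,A]"]
      by (auto simp: subseq_notin_prefix dest: subseq_Cons')
  qed
qed

lemma mem_iff_count: "Y \<in> set p \<longleftrightarrow> count_list p Y \<noteq> 0"
  by (simp add: count_list_0_iff)

text \<open>Here \<open>a\<close>, \<open>b\<close>, \<open>c\<close> count a letter before, on and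
  after an arc. If both occurrences lie in the same segment, or none lies on the arc, the two
  parities agree, so unlinked letters need no separate treatment. The second claim makes the two
  orders of linking exclude each other.\<close>

lemma odd_difference:
  fixes a b c :: nat
  assumes "a + b + c = 0 \<or> a + b + c = 2"
  shows "of_bool (odd (a + b)) - of_bool (odd a) =
    (of_bool (b \<noteq> 0 \<and> c \<noteq> 0) - of_bool (a \<noteq> 0 \<and> b \<noteq> 0) :: int)"
    and "\<not> (a \<noteq> 0 \<and> b \<noteq> 0 \<and> c \<noteq> 0)"
proof -
  have "a = 0 \<or> a = 1 \<or> a = 2" "b = 0 \<or> b = 1 \<or> b = 2" using assms by arith+
  then show "of_bool (odd (a + b)) - of_bool (odd a) =
      (of_bool (b \<noteq> 0 \<and> c \<noteq> 0) - of_bool (a \<noteq> 0 \<and> b \<noteq> 0) :: int)"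
    using assms by (elim disjE) simp_all
  show "\<not> (a \<noteq> 0 \<and> b \<noteq> 0 \<and> c \<noteq> 0)" using assms by arith
qed

text \<open>This replaces the subsequence tests by parities of counts. It covers every
  \<open>Y\<close>: for \<open>Y = A\<close> both counts are 0, in accordance with the convention
  l(A,A) = 0.\<close>

lemma linking_arc:
  assumes "gauss_word (x @ A # y @ A # z)"
  shows "linking (x @ A # y @ A # z, \<tau>) A Y = type_sign (\<tau> A) * type_sign (\<tau> Y) *
    (of_bool (odd (count_list (x @ y) Y)) - of_bool (odd (count_list x Y)))"
proof (cases "A = Y")
  case True
  then show ?thesis using gauss_word_arc[OF assms]
    by (simp add: linking_def linked_def)
next
  case False
  let ?xy = "count_list x Y \<noteq> 0 \<and> count_list y Y \<noteq> 0"
  let ?yz = "count_list y Y \<noteq> 0 \<and> count_list z Y \<noteq> 0"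
  have c: "count_list x Y + count_list y Y + count_list z Y = 0 \<or>
      count_list x Y + count_list y Y + count_list z Y = 2"
    using assms[unfolded gauss_word_def, rule_format, of Y] False by auto
  have "linking (x @ A # y @ A # z, \<tau>) A Y =
      type_sign (\<tau> A) * type_sign (\<tau> Y) * (of_bool ?yz - of_bool ?xy)"
    using False odd_difference(2)[OF c] subseq_arc_iff[OF gauss_word_arc[OF assms] False]
    by (auto simp: linking_def linked_def type_sign_mult mem_iff_count)
  then show ?thesis by (simp only: odd_difference(1)[OF c] count_list_append)
qed

lemma letter_index_arc:
  assumes "gauss_word (x @ A # y @ A # z)"
  shows "letter_index (x @ A # y @ A # z, \<tau>) A =
    type_sign (\<tau> A) * (height \<tau> (x @ y) - height \<tau> x)"
proof -
  let ?S = "set (x @ A # y @ A # z)"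
  have h: "height \<tau> (x @ y) = (\<Sum>Y\<in>?S. type_sign (\<tau> Y) * of_bool (odd (count_list (x @ y) Y)))"
    "height \<tau> x = (\<Sum>Y\<in>?S. type_sign (\<tau> Y) * of_bool (odd (count_list x Y)))"
    by (rule height_superset; auto)+
  show ?thesis
    unfolding letter_index_def fst_conv linking_arc[OF assms] h sum_subtractf[symmetric]
      sum_distrib_left
    by (simp add: algebra_simps)
qed

text \<open>As \<open>linking\<close> tests one alternating pattern before the other, the point is
  that the two never occur together.\<close>

lemma linking_antisym:
  assumes "gauss_word (fst \<alpha>)"
  shows "linking \<alpha> X Y = - linking \<alpha> Y X"
proof (cases "X \<in> set (fst \<alpha>) \<and> X \<noteq> Y")
  case True
  then obtain x y z where w: "fst \<alpha> = x @ X # y @ X # z"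
    using assms gauss_word_obtain_arc by metis
  have "count_list x Y + count_list y Y + count_list z Y \<in> {0, 2}"
    using assms[unfolded gauss_word_def, rule_format, of Y] True w by auto
  then have "\<not> (Y \<in> set x \<and> Y \<in> set y \<and> Y \<in> set z)"
    by (auto simp: mem_iff_count)
  moreover have "gauss_word (x @ X # y @ X # z)" using assms w by simp
  ultimately have "\<not> (subseq [X, Y, X, Y] (fst \<alpha>) \<and> subseq [Y, X, Y, X] (fst \<alpha>))"
    unfolding w using subseq_arc_iff[OF gauss_word_arc] True by (metis (no_types))
  then show ?thesis by (auto simp: linking_def linked_def)
next
  case False
  then have "X = Y \<or> \<not> subseq [X, Y, X, Y] (fst \<alpha>) \<and> \<not> subseq [Y, X, Y, X] (fst \<alpha>)"
    by (auto elim: list_emb_set[where x = X])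
  then show ?thesis by (auto simp: linking_def linked_def)
qed

section \<open>Linking numbers and indices after deleting letters\<close>

lemma subseq_filter_iff:
  assumes "\<forall>X\<in>set l. P X"
  shows "subseq l (filter P w) \<longleftrightarrow> subseq l w"
  using assms subseq_filter[of l w P] subseq_filter_left[of P w]
  by (metis filter_True subseq_order.order_trans)

lemma linking_filter:
  assumes "P X" "P Y" "\<tau>' X = \<tau> X" "\<tau>' Y = \<tau> Y"
  shows "linking (filter P w, \<tau>') X Y = linking (w, \<tau>) X Y"
  using assms by (simp add: linking_def linked_def subseq_filter_iff)

lemma letter_index_filter:
  assumes "X \<in> set w" "P X" "\<And>Y. Y \<in> set w \<Longrightarrow> P Y \<Longrightarrow> \<tau>' Y = \<tau> Y"
  shows "letter_index (w, \<tau>) X =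
    letter_index (filter P w, \<tau>') X + (\<Sum>Y\<in>{Y \<in> set w. \<not> P Y}. linking (w, \<tau>) X Y)"
proof -
  have "letter_index (w, \<tau>) X = (\<Sum>Y\<in>{Y \<in> set w. P Y} \<union> {Y \<in> set w. \<not> P Y}. linking (w, \<tau>) X Y)"
    unfolding letter_index_def by (rule sum.cong) auto
  also have "\<dots> = (\<Sum>Y\<in>{Y \<in> set w. P Y}. linking (w, \<tau>) X Y) +
      (\<Sum>Y\<in>{Y \<in> set w. \<not> P Y}. linking (w, \<tau>) X Y)"
    by (rule sum.union_disjoint) auto
  also have "(\<Sum>Y\<in>{Y \<in> set w. P Y}. linking (w, \<tau>) X Y) = letter_index (filter P w, \<tau>') X"
    unfolding letter_index_def using assms
    by (intro sum.cong) (auto simp: linking_filter)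
  finally show ?thesis .
qed

lemma filter_notin:
  "A \<notin> set v \<Longrightarrow> filter (\<lambda>Z. Z \<noteq> A) v = v"
  "A \<notin> set v \<Longrightarrow> B \<notin> set v \<Longrightarrow> filter (\<lambda>Z. Z \<noteq> A \<and> Z \<noteq> B) v = v"
  "A \<notin> set v \<Longrightarrow> B \<notin> set v \<Longrightarrow> C \<notin> set v \<Longrightarrow>
    filter (\<lambda>Z. Z \<noteq> A \<and> Z \<noteq> B \<and> Z \<noteq> C) v = v"
  by (auto intro!: filter_True)

text \<open>Antisymmetry puts the deleted letter \<open>Y\<close> first, so that
  \<open>linking_arc\<close> can be applied to the displayed arc of \<open>Y\<close> without knowing
  where \<open>X\<close> lies. The second type map allows for words that differ in the type of a
  deleted letter.\<close>

lemma letter_index_remove: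
  assumes "gauss_word w" "X \<in> set w" "X \<notin> M" "M \<subseteq> set w"
    and "v = filter (\<lambda>Z. Z \<notin> M) w" "\<And>Y. Y \<in> set v \<Longrightarrow> \<tau>' Y = \<tau> Y"
  shows "letter_index (w, \<tau>) X = letter_index (v, \<tau>') X - (\<Sum>Y\<in>M. linking (w, \<tau>) Y X)"
proof -
  have "{Y \<in> set w. \<not> Y \<notin> M} = M" using assms by auto
  moreover have "(\<Sum>Y\<in>M. linking (w, \<tau>) X Y) = - (\<Sum>Y\<in>M. linking (w, \<tau>) Y X)"
    unfolding sum_negf[symmetric] using assms by (intro sum.cong refl linking_antisym) simp
  ultimately show ?thesis
    using letter_index_filter[of X w "\<lambda>Z. Z \<notin> M" \<tau>' \<tau>] assms by simp
qed

section \<open>The index under the moves\<close>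

text \<open>The shift replaces the arc \<open>x\<close> of the letter by the complementary arc
  \<open>y\<close>. Since \<open>x @ y\<close> has height 0, this changes the sign of the height
  difference, and the change of type compensates for it.\<close>

lemma letter_index_shift:
  assumes g: "gauss_word (A # x @ A # y)" and g': "gauss_word (x @ A' # y @ [A'])"
    and t: "\<tau>' A' \<noteq> \<tau> A" and eq: "\<forall>X\<in>set x \<union> set y. \<tau>' X = \<tau> X"
  shows "letter_index (x @ A' # y @ [A'], \<tau>') A' = letter_index (A # x @ A # y, \<tau>) A"
    and "X \<in> set x \<union> set y \<Longrightarrow>
      letter_index (x @ A' # y @ [A'], \<tau>') X = letter_index (A # x @ A # y, \<tau>) X"
proof -
  note arc = gauss_word_arc[of "[]" A x y, unfolded append_Nil, OF g]
  note arc' = gauss_word_arc[of x A' y "[]", OF g']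
  have g0: "gauss_word (x @ y)"
    using gauss_word_filter[OF g, of "\<lambda>Z. Z \<noteq> A"] arc by (simp add: filter_notin)
  have "height \<tau>' x = height \<tau> x" using eq by (intro height_cong) auto
  moreover have "height \<tau>' (x @ y) = 0" by (rule height_gauss_word[OF g0])
  moreover have "type_sign (\<tau>' A') = - type_sign (\<tau> A)" using t by (simp add: type_sign_neq)
  ultimately show "letter_index (x @ A' # y @ [A'], \<tau>') A' = letter_index (A # x @ A # y, \<tau>) A"
    using letter_index_arc[of "[]" A x y \<tau>] letter_index_arc[of x A' y "[]" \<tau>'] g g' by simp
  assume X: "X \<in> set x \<union> set y"
  \<comment> \<open>This is the counterpart for a single letter of the vanishing height of
    \<open>x @ y\<close>.\<close>
  have ev: "even (count_list x X + count_list y X)"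
    using g0[unfolded gauss_word_def, rule_format, of X]
    by (metis count_list_append even_numeral even_zero)
  have "letter_index (A # x @ A # y, \<tau>) X =
      letter_index (x @ y, \<tau>) X - (\<Sum>Y\<in>{A}. linking (A # x @ A # y, \<tau>) Y X)"
    using g X arc by (intro letter_index_remove) (auto simp: filter_notin)
  moreover have "letter_index (x @ A' # y @ [A'], \<tau>') X =
      letter_index (x @ y, \<tau>) X - (\<Sum>Y\<in>{A'}. linking (x @ A' # y @ [A'], \<tau>') Y X)"
    using g' X arc' eq by (intro letter_index_remove) (auto simp: filter_notin)
  moreover have "linking (x @ A' # y @ [A'], \<tau>') A' X = linking (A # x @ A # y, \<tau>) A X"
    using linking_arc[of "[]" A x y \<tau> X] linking_arc[of x A' y "[]" \<tau>' X] g g' ev eq X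
      \<open>type_sign (\<tau>' A') = - type_sign (\<tau> A)\<close> by simp
  ultimately show "letter_index (x @ A' # y @ [A'], \<tau>') X = letter_index (A # x @ A # y, \<tau>) X"
    by simp
qed

text \<open>The arc of \<open>A\<close> is empty, so \<open>A\<close> is linked with
  nothing.\<close>

lemma letter_index_H1:
  assumes g: "gauss_word (x @ A # A # y)"
  shows "letter_index (x @ A # A # y, \<tau>) A = 0"
    and "X \<in> set x \<union> set y \<Longrightarrow>
      letter_index (x @ A # A # y, \<tau>) X = letter_index (x @ y, \<tau>) X"
proof -
  note arc = gauss_word_arc[of x A "[]" y, unfolded append_Nil, OF g]
  show "letter_index (x @ A # A # y, \<tau>) A = 0"
    using letter_index_arc[of x A "[]" y \<tau>] g by simp
  assume "X \<in> set x \<union> set y"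
  then have "letter_index (x @ A # A # y, \<tau>) X =
      letter_index (x @ y, \<tau>) X - (\<Sum>Y\<in>{A}. linking (x @ A # A # y, \<tau>) Y X)"
    using g arc by (intro letter_index_remove) (auto simp: filter_notin)
  then show "letter_index (x @ A # A # y, \<tau>) X = letter_index (x @ y, \<tau>) X"
    using linking_arc[of x A "[]" y \<tau> X] g by simp
qed

lemma gauss_word_H2:
  assumes "gauss_word (x @ A # B # y @ B # A # z)"
  shows "A \<noteq> B" "A \<notin> set x \<union> set y \<union> set z" "B \<notin> set x \<union> set y \<union> set z"
  using gauss_word_arc[of x A "B # y @ [B]" z] gauss_word_arc[of "x @ [A]" B y "A # z"] assms
  by auto

text \<open>The arcs of \<open>A\<close> and \<open>B\<close> differ by both occurrences of
  \<open>B\<close>, which parities do not see, while the types are opposite. Hence the contributions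
  of \<open>A\<close> and \<open>B\<close> to any other letter cancel.\<close>

lemma letter_index_H2:
  assumes g: "gauss_word (x @ A # B # y @ B # A # z)" and t: "\<tau> A \<noteq> \<tau> B"
  shows "letter_index (x @ A # B # y @ B # A # z, \<tau>) A =
      - letter_index (x @ A # B # y @ B # A # z, \<tau>) B"
    and "X \<in> set x \<union> set y \<union> set z \<Longrightarrow>
      letter_index (x @ A # B # y @ B # A # z, \<tau>) X = letter_index (x @ y @ z, \<tau>) X"
proof -
  let ?w = "x @ A # B # y @ B # A # z"
  note fresh = gauss_word_H2[OF g]
  have t': "type_sign (\<tau> A) = - type_sign (\<tau> B)" using t by (rule type_sign_neq)
  have "letter_index (?w, \<tau>) A =
      type_sign (\<tau> A) * (height \<tau> (x @ B # y @ [B]) - height \<tau> x)"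
    using letter_index_arc[of x A "B # y @ [B]" z \<tau>] g by simp
  moreover have "letter_index (?w, \<tau>) B =
      type_sign (\<tau> B) * (height \<tau> (x @ A # y) - height \<tau> (x @ [A]))"
    using letter_index_arc[of "x @ [A]" B y "A # z" \<tau>] g by simp
  moreover have "height \<tau> (x @ B # y @ [B]) = height \<tau> (x @ y)"
    using height_insert[of \<tau> x B "y @ [B]"] height_insert[of \<tau> "x @ y" B "[]"] fresh
    by simp
  ultimately show "letter_index (?w, \<tau>) A = - letter_index (?w, \<tau>) B"
    using fresh t' by (simp add: height_insert)
  assume X: "X \<in> set x \<union> set y \<union> set z"
  then have "letter_index (?w, \<tau>) X =
      letter_index (x @ y @ z, \<tau>) X - (\<Sum>Y\<in>{A, B}. linking (?w, \<tau>) Y X)"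
    using g fresh by (intro letter_index_remove) (auto simp: filter_notin)
  moreover have "linking (?w, \<tau>) A X = - linking (?w, \<tau>) B X"
    using linking_arc[of x A "B # y @ [B]" z \<tau> X] linking_arc[of "x @ [A]" B y "A # z" \<tau> X]
      g fresh X t' by auto
  ultimately show "letter_index (?w, \<tau>) X = letter_index (x @ y @ z, \<tau>) X"
    using fresh by simp
qed

lemma gauss_word_H3:
  assumes "gauss_word (x @ A # B # y @ A # C # z @ B # C # t)"
  shows "A \<noteq> B" "A \<noteq> C" "B \<noteq> C" "A \<notin> set x \<union> set y \<union> set z \<union> set t"
    "B \<notin> set x \<union> set y \<union> set z \<union> set t" "C \<notin> set x \<union> set y \<union> set z \<union> set t"
  using gauss_word_arc[of x A "B # y" "C # z @ B # C # t"]
    gauss_word_arc[of "x @ [A]" B "y @ A # C # z" "C # t"]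
    gauss_word_arc[of "x @ A # B # y @ [A]" C "z @ [B]" t] assms
  by auto

text \<open>Apart from the letters of the move, the arcs of \<open>A\<close>, \<open>C\<close> and
  \<open>B\<close> run over \<open>y\<close>, \<open>z\<close> and both in turn, so the height
  differences telescope.\<close>

lemma letter_index_H3:
  assumes g: "gauss_word (x @ A # B # y @ A # C # z @ B # C # t)"
    and g': "gauss_word (x @ B # A # y @ C # A # z @ C # B # t)"
    and tt: "\<tau> A = \<tau> B" "\<tau> B = \<tau> C"
  defines "\<alpha> \<equiv> (x @ A # B # y @ A # C # z @ B # C # t, \<tau>)"
    and "\<beta> \<equiv> (x @ B # A # y @ C # A # z @ C # B # t, \<tau>)"
  shows "letter_index \<alpha> B = letter_index \<alpha> A + letter_index \<alpha> C"
    and "X \<in> set (fst \<alpha>) \<Longrightarrow> letter_index \<beta> X = letter_index \<alpha> X"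
proof -
  note fresh = gauss_word_H3[OF g]
  note fresh' = fresh fresh(1-3)[symmetric]
  let ?s = "type_sign (\<tau> A)"
  have s: "type_sign (\<tau> B) = ?s" "type_sign (\<tau> C) = ?s" using tt by simp_all
  \<comment> \<open>The constants come from the letters of the move: in \<alpha>, \<open>A\<close>
    links \<open>B\<close> and \<open>B\<close> links \<open>C\<close>, which gives
    \<open>+ 1\<close>, \<open>0\<close>, \<open>- 1\<close> for \<open>A\<close>, \<open>B\<close>,
    \<open>C\<close>.\<close>
  have iA: "letter_index \<alpha> A = ?s * (height \<tau> (x @ y) - height \<tau> x) + 1"
    using letter_index_arc[of x A "B # y" "C # z @ B # C # t" \<tau>] g fresh' s
    by (simp add: \<alpha>_def height_insert algebra_simps)
  have iB: "letter_index \<alpha> B = ?s * (height \<tau> (x @ y @ z) - height \<tau> x)"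
    using letter_index_arc[of "x @ [A]" B "y @ A # C # z" "C # t" \<tau>] g fresh' s
      height_insert[of \<tau> "x @ y" C z] height_insert[of \<tau> "x @ y" A "C # z"]
      height_insert[of \<tau> x A "y @ A # C # z"]
    by (simp add: \<alpha>_def height_insert algebra_simps)
  have iC: "letter_index \<alpha> C = ?s * (height \<tau> (x @ y @ z) - height \<tau> (x @ y)) - 1"
    using letter_index_arc[of "x @ A # B # y @ [A]" C "z @ [B]" t \<tau>] g fresh' s
      height_insert[of \<tau> "x @ y" A "z @ [B]"] height_insert[of \<tau> "x @ y @ z" B "[]"]
      height_insert[of \<tau> "x @ y" A "[]"]
    by (simp add: \<alpha>_def height_insert algebra_simps)
  show "letter_index \<alpha> B = letter_index \<alpha> A + letter_index \<alpha> C"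
    using iA iB iC by (simp add: algebra_simps)
  \<comment> \<open>In \<beta> only \<open>A\<close> and \<open>C\<close> are linked with each
    other, which yields the same constants.\<close>
  have jA: "letter_index \<beta> A = ?s * (height \<tau> (x @ y) - height \<tau> x) + 1"
    using letter_index_arc[of "x @ [B]" A "y @ [C]" "z @ C # B # t" \<tau>] g' fresh' s
      height_insert[of \<tau> "x @ y" C "[]"]
    by (simp add: \<beta>_def height_insert algebra_simps)
  have jB: "letter_index \<beta> B = ?s * (height \<tau> (x @ y @ z) - height \<tau> x)"
    using letter_index_arc[of x B "A # y @ C # A # z @ [C]" t \<tau>] g' fresh' s
      height_insert[of \<tau> "x @ y" C "A # z @ [C]"] height_insert[of \<tau> "x @ y" A "z @ [C]"]
      height_insert[of \<tau> "x @ y @ z" C "[]"]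
    by (simp add: \<beta>_def height_insert algebra_simps)
  have jC: "letter_index \<beta> C = ?s * (height \<tau> (x @ y @ z) - height \<tau> (x @ y)) - 1"
    using letter_index_arc[of "x @ B # A # y" C "A # z" "B # t" \<tau>] g' fresh' s
      height_insert[of \<tau> "x @ y" A z]
    by (simp add: \<beta>_def height_insert algebra_simps)
  assume X: "X \<in> set (fst \<alpha>)"
  show "letter_index \<beta> X = letter_index \<alpha> X"
  proof (cases "X \<in> {A, B, C}")
    case True
    then show ?thesis using iA iB iC jA jB jC by auto
  next
    case False
    \<comment> \<open>Deleting \<open>A\<close>, \<open>B\<close>, \<open>C\<close> leaves the same
      word on both sides, and each of the three has the same count of \<open>X\<close> before and on
      its arc in both words.\<close>
    have "letter_index \<alpha> X =
        letter_index (x @ y @ z @ t, \<tau>) X - (\<Sum>Y\<in>{A, B, C}. linking \<alpha> Y X)"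
      unfolding \<alpha>_def using g fresh X False
      by (intro letter_index_remove) (auto simp: \<alpha>_def filter_notin)
    moreover have "letter_index \<beta> X =
        letter_index (x @ y @ z @ t, \<tau>) X - (\<Sum>Y\<in>{A, B, C}. linking \<beta> Y X)"
      unfolding \<beta>_def using g' fresh X False
      by (intro letter_index_remove) (auto simp: \<alpha>_def filter_notin)
    moreover have "linking \<alpha> A X = linking \<beta> A X"
      using False linking_arc[of x A "B # y" "C # z @ B # C # t" \<tau> X] g
        linking_arc[of "x @ [B]" A "y @ [C]" "z @ C # B # t" \<tau> X] g'
      by (simp add: \<alpha>_def \<beta>_def)
    moreover have "linking \<alpha> B X = linking \<beta> B X"
      using False linking_arc[of "x @ [A]" B "y @ A # C # z" "C # t" \<tau> X] g
        linking_arc[of x B "A # y @ C # A # z @ [C]" t \<tau> X] g'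
      by (simp add: \<alpha>_def \<beta>_def)
    moreover have "linking \<alpha> C X = linking \<beta> C X"
      using False linking_arc[of "x @ A # B # y @ [A]" C "z @ [B]" t \<tau> X] g
        linking_arc[of "x @ B # A # y" C "A # z" "B # t" \<tau> X] g'
      by (simp add: \<alpha>_def \<beta>_def)
    ultimately show ?thesis using fresh by simp
  qed
qed

lemma letter_index_iso:
  assumes "inj_on f (set w)" "\<forall>X\<in>set w. \<tau>' (f X) = \<tau> X" "X \<in> set w"
  shows "letter_index (map f w, \<tau>') (f X) = letter_index (w, \<tau>) X"
proof -
  have sub: "subseq (map f l) (map f w) \<longleftrightarrow> subseq l w" if "set l \<subseteq> set w" for l
  proof
    assume "subseq (map f l) (map f w)"
    then have "subseq (map (inv_into (set w) f) (map f l)) (map (inv_into (set w) f) (map f w))"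
      by (rule subseq_map)
    moreover have "map (inv_into (set w) f) (map f l) = l"
      using that assms(1) by (auto intro!: map_idI)
    moreover have "map (inv_into (set w) f) (map f w) = w"
      using assms(1) by (auto intro!: map_idI)
    ultimately show "subseq l w" by simp
  qed (rule subseq_map)
  have "linking (map f w, \<tau>') (f X) (f Y) = linking (w, \<tau>) X Y" if "Y \<in> set w" for Y
    using sub[of "[X, Y, X, Y]"] sub[of "[Y, X, Y, X]"] that assms
    by (simp add: linking_def linked_def inj_on_eq_iff)
  then show ?thesis
    using assms(1) by (simp add: letter_index_def sum.reindex)
qed

section \<open>Homotopy invariance\<close>

lemma homotopy_moveI:
  "\<alpha> \<in> nanowords \<Longrightarrow> \<beta> \<in> nanowords \<Longrightarrow> nanoword_move \<alpha> \<beta> \<Longrightarrow> (\<alpha>, \<beta>) \<in> homotopy"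
  by (auto simp: homotopy_def homotopy_step_def intro!: r_into_equivclp)

lemma homotopy_isoI:
  "\<alpha> \<in> nanowords \<Longrightarrow> \<beta> \<in> nanowords \<Longrightarrow> nanoword_iso \<alpha> \<beta> \<Longrightarrow> (\<alpha>, \<beta>) \<in> homotopy"
  by (auto simp: homotopy_def homotopy_step_def intro!: r_into_equivclp)

lemma homotopy_refl: "\<alpha> \<in> nanowords \<Longrightarrow> (\<alpha>, \<alpha>) \<in> homotopy"
  by (simp add: homotopy_def)

text \<open>The identity relabelling is an isomorphism, because type values off the word carry no
  meaning.\<close>

lemma homotopy_retype:
  assumes "gauss_word w" "\<forall>X\<in>set w. \<tau>' X = \<tau> X"
  shows "((w, \<tau>), (w, \<tau>')) \<in> homotopy"
  using assms by (intro homotopy_isoI) (auto simp: nanowords_def nanoword_iso_def intro!: exI[of _ id])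

lemma covering_nanoword: "\<alpha> \<in> nanowords \<Longrightarrow> covering r \<alpha> \<in> nanowords"
  by (auto simp: covering_def nanowords_def gauss_word_filter)

text \<open>Letters outside the move keep their index, so both sides are filtered alike there. If
  all letters of the move survive, the same move relates the coverings; otherwise at most one
  survives, in H3, and the move becomes invisible.\<close>

lemma covering_move:
  assumes "\<alpha> \<in> nanowords" "\<beta> \<in> nanowords" "nanoword_move \<alpha> \<beta>"
  shows "(covering r \<alpha>, covering r \<beta>) \<in> homotopy"
proof -
  note cov = covering_nanoword[OF assms(1), of r] covering_nanoword[OF assms(2), of r]
  from assms(3) show ?thesis
  proof cases
    case (shift \<tau>' A' \<tau> A x y)
    have g: "gauss_word (A # x @ A # y)" "gauss_word (x @ A' # y @ [A'])"
      using assms shift by (auto simp: nanowords_def)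
    note i = letter_index_shift[OF g shift(3,4)]
    define P where "P = (\<lambda>X. int r dvd letter_index (A # x @ A # y, \<tau>) X)"
    have f: "filter (\<lambda>X. int r dvd letter_index (x @ A' # y @ [A'], \<tau>') X) x = filter P x"
      "filter (\<lambda>X. int r dvd letter_index (x @ A' # y @ [A'], \<tau>') X) y = filter P y"
      using i(2) by (auto simp: P_def intro!: filter_cong)
    have c: "covering r \<alpha> = (filter P (A # x @ A # y), \<tau>)"
      by (simp add: covering_def shift P_def)
    have c': "covering r \<beta> = (if P A then filter P x @ [A'] @ filter P y @ [A'] else filter P (x @ y), \<tau>')"
      using f i(1) by (simp add: covering_def shift) (simp add: P_def)
    show ?thesis
    proof (cases "P A")
      case True
      have "nanoword_move ([A] @ filter P x @ [A] @ filter P y, \<tau>)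
          (filter P x @ [A'] @ filter P y @ [A'], \<tau>')"
        using shift(3,4) by (intro nanoword_move.shift) auto
      with True show ?thesis using cov c c' by (intro homotopy_moveI) auto
    next
      case False
      \<comment> \<open>Both coverings now have the same word, but the two type maps may still
        differ off it.\<close>
      then show ?thesis using cov shift(4) unfolding c c'
        by (auto simp: nanowords_def intro!: homotopy_retype)
    qed
  next
    case (H1 x A y \<tau>)
    have g: "gauss_word (x @ A # A # y)" using assms H1 by (auto simp: nanowords_def)
    note i = letter_index_H1[OF g, where \<tau> = \<tau>]
    define P where "P = (\<lambda>X. int r dvd letter_index (x @ A # A # y, \<tau>) X)"
    have f: "filter (\<lambda>X. int r dvd letter_index (x @ y, \<tau>) X) x = filter P x"
      "filter (\<lambda>X. int r dvd letter_index (x @ y, \<tau>) X) y = filter P y"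
      using i(2) by (auto simp: P_def intro!: filter_cong)
    have "P A" using i(1) by (simp add: P_def)
    then have "covering r \<alpha> = (filter P x @ [A, A] @ filter P y, \<tau>)"
      by (simp add: covering_def H1 P_def)
    moreover have "covering r \<beta> = (filter P x @ filter P y, \<tau>)"
      by (simp add: covering_def H1 f)
    ultimately show ?thesis using cov nanoword_move.H1 by (intro homotopy_moveI) auto
  next
    case (H2 \<tau> A B x y z)
    have g: "gauss_word (x @ A # B # y @ B # A # z)" using assms H2 by (auto simp: nanowords_def)
    note i = letter_index_H2[OF g H2(3)]
    define P where "P = (\<lambda>X. int r dvd letter_index (x @ A # B # y @ B # A # z, \<tau>) X)"
    have f: "filter (\<lambda>X. int r dvd letter_index (x @ y @ z, \<tau>) X) x = filter P x"
      "filter (\<lambda>X. int r dvd letter_index (x @ y @ z, \<tau>) X) y = filter P y"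
      "filter (\<lambda>X. int r dvd letter_index (x @ y @ z, \<tau>) X) z = filter P z"
      using i(2) by (auto simp: P_def intro!: filter_cong)
    \<comment> \<open>Opposite indices have the same divisors, so \<open>A\<close> and
      \<open>B\<close> are kept or deleted together.\<close>
    have PB: "P B = P A" using i(1) by (simp add: P_def)
    have c: "covering r \<alpha> = (filter P (x @ A # B # y @ B # A # z), \<tau>)"
      by (simp add: covering_def H2 P_def)
    have c': "covering r \<beta> = (filter P x @ filter P y @ filter P z, \<tau>)"
      by (simp add: covering_def H2 f)
    show ?thesis
    proof (cases "P A")
      case True
      then show ?thesis
        using cov c c' PB nanoword_move.H2[OF H2(3), of "filter P x" "filter P y" "filter P z"]
        by (intro homotopy_moveI) auto
    next
      case False
      then have "covering r \<alpha> = covering r \<beta>" using c c' PB by simp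
      then show ?thesis using cov homotopy_refl by simp
    qed
  next
    case (H3 \<tau> A B C x y z t)
    let ?w = "x @ A # B # y @ A # C # z @ B # C # t"
    let ?w' = "x @ B # A # y @ C # A # z @ C # B # t"
    have g: "gauss_word ?w" "gauss_word ?w'"
      using assms H3 by (auto simp: nanowords_def)
    note i = letter_index_H3[OF g H3(3,4)]
    define P where "P = (\<lambda>X. int r dvd letter_index (?w, \<tau>) X)"
    have "set ?w' = set ?w" by auto
    then have "int r dvd letter_index (?w', \<tau>) X \<longleftrightarrow> P X" if "X \<in> set ?w'" for X
      using i(2)[of X] that unfolding P_def fst_conv by metis
    then have "filter (\<lambda>X. int r dvd letter_index (?w', \<tau>) X) ?w' = filter P ?w'"
      by (rule filter_cong[OF refl])
    then have c': "covering r \<beta> = (filter P ?w', \<tau>)"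
      by (simp add: covering_def H3)
    have c: "covering r \<alpha> = (filter P ?w, \<tau>)"
      by (simp add: covering_def H3 P_def)
    \<comment> \<open>As \<open>n(B) = n(A) + n(C)\<close>, the covering never keeps exactly two of the three letters.\<close>
    have "P A \<and> P B \<and> P C \<or> \<not> P A \<and> \<not> P B \<or> \<not> P A \<and> \<not> P C \<or> \<not> P B \<and> \<not> P C"
    proof (cases "P A")
      case True
      then show ?thesis using i(1) by (simp add: P_def dvd_add_right_iff)
    next
      case False
      then show ?thesis using i(1) by (auto simp: P_def dvd_add_left_iff)
    qed
    \<comment> \<open>With two of the letters gone, each of the three swapped pairs has lost a
      letter, and the filtered words coincide.\<close>
    then consider "P A" "P B" "P C" | "filter P ?w = filter P ?w'"
      by (elim disjE conjE) simp_all
    then show ?thesis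
    proof cases
      case 1
      then show ?thesis
        using cov c c' nanoword_move.H3[OF H3(3,4), of "filter P x" "filter P y" "filter P z" "filter P t"]
        by (intro homotopy_moveI) auto
    next
      case 2
      then show ?thesis using cov c c' homotopy_refl by simp
    qed
  qed
qed

lemma covering_iso:
  assumes "nanoword_iso \<alpha> \<beta>"
  shows "nanoword_iso (covering r \<alpha>) (covering r \<beta>)"
proof -
  obtain f where f: "bij_betw f (set (fst \<alpha>)) (set (fst \<beta>))" "fst \<beta> = map f (fst \<alpha>)"
    "\<forall>X\<in>set (fst \<alpha>). snd \<beta> (f X) = snd \<alpha> X"
    using assms by (auto simp: nanoword_iso_def)
  have inj: "inj_on f (set (fst \<alpha>))" using f by (simp add: bij_betw_def)
  have "letter_index \<beta> (f X) = letter_index \<alpha> X" if "X \<in> set (fst \<alpha>)" for X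
    using letter_index_iso[OF inj f(3) that] f(2) by (metis prod.collapse)
  then have "filter ((\<lambda>X. int r dvd letter_index \<beta> X) \<circ> f) (fst \<alpha>) =
      filter (\<lambda>X. int r dvd letter_index \<alpha> X) (fst \<alpha>)"
    by (intro filter_cong) simp_all
  then have "fst (covering r \<beta>) = map f (fst (covering r \<alpha>))"
    by (simp add: covering_def f(2) filter_map)
  moreover from this have "bij_betw f (set (fst (covering r \<alpha>))) (set (fst (covering r \<beta>)))"
    using inj_on_subset[OF inj] by (auto simp: bij_betw_def covering_def)
  ultimately show ?thesis
    using f(3) by (auto simp: nanoword_iso_def covering_def intro!: exI[of _ f])
qed

lemma covering_homotopy:
  assumes "(\<alpha>, \<beta>) \<in> homotopy"
  shows "(covering r \<alpha>, covering r \<beta>) \<in> homotopy"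
proof -
  have "equivclp homotopy_step \<alpha> \<beta>" "\<alpha> \<in> nanowords" using assms by (auto simp: homotopy_def)
  then show ?thesis
  proof (induction rule: equivclp_induct)
    case base
    then show ?case by (simp add: homotopy_refl covering_nanoword)
  next
    case (step \<beta> \<gamma>)
    \<comment> \<open>Stated for arbitrary nanowords, since a step of the equivalence closure may
      run in either direction.\<close>
    have *: "(covering r \<alpha>, covering r \<beta>) \<in> homotopy" if "homotopy_step \<alpha> \<beta>" for \<alpha> \<beta>
      using that unfolding homotopy_step_def
      by (auto intro: covering_move homotopy_isoI covering_iso covering_nanoword)
    then have "(covering r \<beta>, covering r \<gamma>) \<in> homotopy"
      using step equiv_homotopy by (metis equiv_def symD)
    then show ?case using step equiv_homotopy by (metis equiv_def transD)
  qed
qed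

section \<open>Homotopy invariants counting letters by index\<close>

definition index_sum :: "(int \<Rightarrow> int) \<Rightarrow> typed_word \<Rightarrow> int" where
  "index_sum \<phi> \<alpha> = (\<Sum>X\<in>set (fst \<alpha>). \<phi> (letter_index \<alpha> X))"

text \<open>Shift and H3 preserve the indices of all letters, H1 removes a letter of index 0, and H2
  removes two letters of opposite indices. Oddness of \<phi> makes the removed terms vanish or
  cancel.\<close>

lemma index_sum_move:
  assumes "\<And>n. \<phi> (- n) = - \<phi> n" "\<alpha> \<in> nanowords" "\<beta> \<in> nanowords" "nanoword_move \<alpha> \<beta>"
  shows "index_sum \<phi> \<alpha> = index_sum \<phi> \<beta>"
  using assms(4)
proof cases
  case (shift \<tau>' A' \<tau> A x y)
  have g: "gauss_word (A # x @ A # y)" "gauss_word (x @ A' # y @ [A'])"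
    using assms shift by (auto simp: nanowords_def)
  have "A \<notin> set x \<union> set y" "A' \<notin> set x \<union> set y"
    using gauss_word_arc[of "[]" A x y] gauss_word_arc[of x A' y "[]"] g by auto
  then show ?thesis
    using letter_index_shift[OF g shift(3,4)] by (simp add: index_sum_def shift)
next
  case (H1 x A y \<tau>)
  have g: "gauss_word (x @ A # A # y)" using assms H1 by (auto simp: nanowords_def)
  have "A \<notin> set x \<union> set y" using gauss_word_arc[of x A "[]" y] g by auto
  moreover have "\<phi> 0 = 0" using assms(1)[of 0] by simp
  ultimately show ?thesis
    using letter_index_H1[OF g] by (simp add: index_sum_def H1)
next
  case (H2 \<tau> A B x y z)
  have g: "gauss_word (x @ A # B # y @ B # A # z)" using assms H2 by (auto simp: nanowords_def)
  have "set x \<union> insert A (insert B (set y \<union> insert B (insert A (set z)))) =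
      insert A (insert B (set x \<union> (set y \<union> set z)))" by auto
  then show ?thesis
    using letter_index_H2[OF g H2(3)] gauss_word_H2[OF g] assms(1)
    by (simp add: index_sum_def H2)
next
  case (H3 \<tau> A B C x y z t)
  have "gauss_word (x @ A # B # y @ A # C # z @ B # C # t)"
    "gauss_word (x @ B # A # y @ C # A # z @ C # B # t)"
    using assms H3 by (auto simp: nanowords_def)
  note i = letter_index_H3(2)[OF this H3(3,4)]
  have "set (fst \<beta>) = set (fst \<alpha>)" by (auto simp: H3)
  then show ?thesis
    unfolding index_sum_def using i by (intro sum.cong) (simp_all add: H3)
qed

lemma index_sum_iso:
  assumes "nanoword_iso \<alpha> \<beta>"
  shows "index_sum \<phi> \<alpha> = index_sum \<phi> \<beta>"
proof -
  obtain f where f: "bij_betw f (set (fst \<alpha>)) (set (fst \<beta>))" "fst \<beta> = map f (fst \<alpha>)"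
    "\<forall>X\<in>set (fst \<alpha>). snd \<beta> (f X) = snd \<alpha> X"
    using assms by (auto simp: nanoword_iso_def)
  have inj: "inj_on f (set (fst \<alpha>))" using f by (simp add: bij_betw_def)
  have "letter_index \<beta> (f X) = letter_index \<alpha> X" if "X \<in> set (fst \<alpha>)" for X
    using letter_index_iso[OF inj f(3) that] f(2) by (metis prod.collapse)
  then show ?thesis
    unfolding index_sum_def sum.reindex_bij_betw[OF f(1), symmetric] by simp
qed

lemma index_sum_homotopy:
  assumes "(\<alpha>, \<beta>) \<in> homotopy" "\<And>n. \<phi> (- n) = - \<phi> n"
  shows "index_sum \<phi> \<alpha> = index_sum \<phi> \<beta>"
proof -
  have "equivclp homotopy_step \<alpha> \<beta>" using assms by (auto simp: homotopy_def)
  then show ?thesis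
  proof (induction rule: equivclp_induct)
    case (step \<beta> \<gamma>)
    then show ?case
      using index_sum_move[where \<phi> = \<phi>, OF assms(2)] index_sum_iso
      unfolding homotopy_step_def by metis
  qed simp
qed

section \<open>The covering map on homotopy classes\<close>

lemma vs_covering_class:
  assumes "\<alpha> \<in> nanowords"
  shows "vs_covering r (homotopy `` {\<alpha>}) = homotopy `` {covering r \<alpha>}"
proof -
  have "homotopy `` {covering r \<beta>} = homotopy `` {covering r \<alpha>}" if "(\<alpha>, \<beta>) \<in> homotopy" for \<beta>
    using covering_homotopy[OF that] equiv_class_eq[OF equiv_homotopy] by blast
  then have "vs_covering r (homotopy `` {\<alpha>}) = (\<Union>\<beta>\<in>homotopy `` {\<alpha>}. homotopy `` {covering r \<alpha>})"
    unfolding vs_covering_def by (intro SUP_cong) simp_all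
  also have "\<dots> = homotopy `` {covering r \<alpha>}"
    using homotopy_refl[OF assms] by blast
  finally show ?thesis .
qed

section \<open>Prescribing the indices\<close>

lemma obtain_type_sign:
  assumes "d = 1 \<or> d = -1"
  obtains c where "type_sign c = d"
  using assms that[of Type_a] that[of Type_b] by (auto simp: type_sign_def)

lemma letter_index_pendant:
  assumes g: "gauss_word (u @ A # v)" and P: "P \<notin> set (u @ A # v)" and s: "s = 1 \<or> s = -1"
  obtains c where
    "gauss_word (u @ P # A # P # v)"
    "letter_index (u @ P # A # P # v, \<tau>(P := c)) P = - s"
    "\<And>X. X \<in> set (u @ A # v) \<Longrightarrow> letter_index (u @ P # A # P # v, \<tau>(P := c)) X =
      letter_index (u @ A # v, \<tau>) X + (if X = A then s else 0)"
proof -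
  \<comment> \<open>This sign records whether the enclosed \<open>A\<close> is its first or its
    second occurrence, that is, in which order \<open>P\<close> and \<open>A\<close>
    alternate.\<close>
  define e :: int where "e = (if odd (count_list u A) then -1 else 1)"
  \<comment> \<open>The linking number of \<open>P\<close> with \<open>A\<close> is the product of
    both type signs and \<open>e\<close>. It has to be \<open>- s\<close> for \<open>A\<close> to
    gain \<open>s\<close>, and as all factors are 1 or -1 this can be solved for the sign of
    \<open>P\<close>.\<close>
  have "- s * type_sign (\<tau> A) * e = 1 \<or> - s * type_sign (\<tau> A) * e = -1"
    using s by (auto simp: type_sign_def e_def)
  then obtain c where c: "type_sign c = - s * type_sign (\<tau> A) * e"
    using obtain_type_sign by blast
  let ?w = "u @ P # A # P # v" and ?\<tau> = "\<tau>(P := c)"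
  have cw: "count_list ?w X = (if X = P then 2 else count_list (u @ A # v) X)" for X
    using P by (auto simp: count_list_0_iff)
  have g': "gauss_word ?w" using g unfolding gauss_word_def cw by simp
  have ee: "e * e = 1" by (simp add: e_def)
  have "A \<noteq> P" using P by auto
  have link: "linking (?w, ?\<tau>) P X = (if X = A then - s else 0)" for X
  proof -
    have "linking (?w, ?\<tau>) P X = type_sign c * type_sign (?\<tau> X) *
        (of_bool (odd (count_list (u @ [A]) X)) - of_bool (odd (count_list u X)))"
      using linking_arc[of u P "[A]" v ?\<tau> X] g' by simp
    also have "\<dots> = (if X = A then type_sign c * type_sign (\<tau> A) * e else 0)"
      using \<open>A \<noteq> P\<close> by (auto simp: e_def)
    also have "type_sign c * type_sign (\<tau> A) * e =
        - s * (type_sign (\<tau> A) * type_sign (\<tau> A)) * (e * e)"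
      by (simp only: c mult.assoc mult.commute mult.left_commute)
    finally show ?thesis unfolding ee type_sign_mult_self mult_1_right .
  qed
  have "letter_index (?w, ?\<tau>) P = - s"
    unfolding letter_index_def link by simp
  moreover have "letter_index (?w, ?\<tau>) X =
      letter_index (u @ A # v, \<tau>) X + (if X = A then s else 0)" if X: "X \<in> set (u @ A # v)" for X
  proof -
    have "letter_index (?w, ?\<tau>) X =
        letter_index (u @ A # v, \<tau>) X - (\<Sum>Y\<in>{P}. linking (?w, ?\<tau>) Y X)"
      using g' X P by (intro letter_index_remove) (auto simp: filter_notin)
    then show ?thesis by (simp add: link)
  qed
  ultimately show ?thesis using that[OF g'] by blast
qed

text \<open>Induction on the total distance of the indices from their targets: each pendant letter
  moves one index a unit closer. Pendants are hung only on letters of \<open>w\<close>, so those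
  added earlier keep their index of absolute value 1.\<close>

lemma prescribe_indices:
  assumes "gauss_word w"
  obtains w' \<tau>' where "gauss_word w'" "filter (\<lambda>X. X \<in> set w) w' = w"
    "\<And>X. X \<in> set w \<Longrightarrow> \<tau>' X = \<tau> X"
    "\<And>X. X \<in> set w \<Longrightarrow> letter_index (w', \<tau>') X = f X"
    "\<And>X. X \<in> set w' - set w \<Longrightarrow> \<bar>letter_index (w', \<tau>') X\<bar> = 1"
proof -
  define good where "good w' \<tau>' \<longleftrightarrow> gauss_word w' \<and> filter (\<lambda>X. X \<in> set w) w' = w \<and>
    (\<forall>X\<in>set w. \<tau>' X = \<tau> X) \<and> (\<forall>X\<in>set w' - set w. \<bar>letter_index (w', \<tau>') X\<bar> = 1)"
    for w' \<tau>'
  define err where "err w' \<tau>' = (\<Sum>X\<in>set w. nat \<bar>f X - letter_index (w', \<tau>') X\<bar>)" for w' \<tau>'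
  have "\<exists>w'' \<tau>''. good w'' \<tau>'' \<and> (\<forall>X\<in>set w. letter_index (w'', \<tau>'') X = f X)"
    if "good w' \<tau>'" for w' \<tau>'
    using that
  proof (induction "err w' \<tau>'" arbitrary: w' \<tau>' rule: less_induct)
    case less
    show ?case
    proof (cases "\<forall>X\<in>set w. letter_index (w', \<tau>') X = f X")
      case True
      then show ?thesis using less.prems by blast
    next
      case False
      then obtain A where A: "A \<in> set w" "letter_index (w', \<tau>') A \<noteq> f A" by blast
      have sub: "set w \<subseteq> set w'" and fil: "filter (\<lambda>X. X \<in> set w) w' = w"
        using less.prems unfolding good_def by (metis filter_is_subset)+
      then obtain u v where w': "w' = u @ A # v" using A split_list by (metis subsetD)
      obtain P where P: "P \<notin> set w'" using ex_new_if_finite[OF infinite_UNIV_nat] by blast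
      \<comment> \<open>The sign points from the current index of \<open>A\<close> towards its
        target.\<close>
      define s where "s = sgn (f A - letter_index (w', \<tau>') A)"
      have s: "s = 1 \<or> s = -1" using A by (auto simp: s_def sgn_if)
      have "gauss_word (u @ A # v)" "P \<notin> set (u @ A # v)"
        using less.prems P by (simp_all add: good_def w')
      then obtain c where g: "gauss_word (u @ P # A # P # v)"
        and iP: "letter_index (u @ P # A # P # v, \<tau>'(P := c)) P = - s"
        and iX: "\<And>X. X \<in> set (u @ A # v) \<Longrightarrow>
          letter_index (u @ P # A # P # v, \<tau>'(P := c)) X =
          letter_index (u @ A # v, \<tau>') X + (if X = A then s else 0)"
        using letter_index_pendant[OF _ _ s, where \<tau> = \<tau>'] by metis
      let ?w = "u @ P # A # P # v" and ?\<tau> = "\<tau>'(P := c)"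
      have Pw: "P \<notin> set w" using P sub by auto
      have good: "good ?w ?\<tau>"
        unfolding good_def
      proof (intro conjI ballI)
        show "filter (\<lambda>X. X \<in> set w) ?w = w" using fil Pw A(1) by (simp add: w')
        show "?\<tau> X = \<tau> X" if "X \<in> set w" for X
          using that less.prems Pw by (auto simp: good_def)
        show "\<bar>letter_index (?w, ?\<tau>) X\<bar> = 1" if "X \<in> set ?w - set w" for X
        proof (cases "X = P")
          case True
          then show ?thesis using iP s by auto
        next
          case False
          then have "X \<in> set w' - set w" using that w' by auto
          moreover from this have "X \<noteq> A" using A by auto
          ultimately show ?thesis using iX[of X] less.prems by (auto simp: good_def w')
        qed
      qed (rule g)
      \<comment> \<open>Only the term of \<open>A\<close> changes, and it drops by 1.\<close>
      have "err ?w ?\<tau> < err w' \<tau>'"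
        unfolding err_def
      proof (rule sum_strict_mono_ex1)
        have i: "letter_index (?w, ?\<tau>) X = letter_index (w', \<tau>') X + (if X = A then s else 0)"
          if "X \<in> set w" for X
          using iX[of X] that sub w' by auto
        have lt: "nat \<bar>f A - letter_index (?w, ?\<tau>) A\<bar> < nat \<bar>f A - letter_index (w', \<tau>') A\<bar>"
          unfolding i[OF A(1)] using A(2) by (auto simp: s_def sgn_if)
        then show "\<exists>X\<in>set w. nat \<bar>f X - letter_index (?w, ?\<tau>) X\<bar> < nat \<bar>f X - letter_index (w', \<tau>') X\<bar>"
          using A(1) by blast
        show "\<forall>X\<in>set w. nat \<bar>f X - letter_index (?w, ?\<tau>) X\<bar> \<le> nat \<bar>f X - letter_index (w', \<tau>') X\<bar>"
        proof
          fix X assume "X \<in> set w"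
          then show "nat \<bar>f X - letter_index (?w, ?\<tau>) X\<bar> \<le> nat \<bar>f X - letter_index (w', \<tau>') X\<bar>"
            using less_imp_le[OF lt] i[of X] by (cases "X = A") (simp_all only: if_False add_0_right order_refl)
        qed
      qed simp
      then show ?thesis using good by (rule less.hyps)
    qed
  qed
  moreover have "good w \<tau>" using assms by (simp add: good_def)
  ultimately obtain w'' \<tau>'' where
    "good w'' \<tau>''" "\<forall>X\<in>set w. letter_index (w'', \<tau>'') X = f X" by blast
  then show ?thesis using that unfolding good_def by blast
qed

section \<open>Preimages told apart by their invariants\<close>

text \<open>An odd function whose \<open>index_sum\<close> is, for \<open>m > 0\<close>, the
  coefficient of degree \<open>m\<close> of the u-polynomial.\<close>

definition index_test :: "int \<Rightarrow> int \<Rightarrow> int" where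
  "index_test m n = of_bool (n = m) - of_bool (n = - m)"

lemma index_test_minus: "index_test m (- n) = - index_test m n"
  by (simp add: index_test_def minus_equation_iff[of n] eq_commute[of m])

lemma covering_preimage:
  assumes "r \<noteq> 1" "\<alpha> \<in> nanowords" "k \<ge> 2" "\<not> r dvd k"
  obtains \<beta> where "\<beta> \<in> nanowords" "(covering r \<beta>, \<alpha>) \<in> homotopy"
    "\<And>m::nat. m \<ge> 2 \<Longrightarrow> index_sum (index_test (int m)) \<beta> = of_bool (m = k)"
proof -
  obtain w \<tau> where \<alpha>: "\<alpha> = (w, \<tau>)" "gauss_word w"
    using assms(2) by (auto simp: nanowords_def)
  obtain X where X: "X \<notin> set w" using ex_new_if_finite[OF infinite_UNIV_nat] by blast
  let ?w = "w @ [X, X]"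
  have "gauss_word ?w"
    using \<alpha>(2) X by (auto simp: gauss_word_def count_list_0_iff)
  then obtain w' \<tau>' where g: "gauss_word w'" and fil: "filter (\<lambda>Y. Y \<in> set ?w) w' = ?w"
    and t: "\<And>Y. Y \<in> set ?w \<Longrightarrow> \<tau>' Y = \<tau> Y"
    and old: "\<And>Y. Y \<in> set ?w \<Longrightarrow> letter_index (w', \<tau>') Y = (if Y = X then int k else 0)"
    and new: "\<And>Y. Y \<in> set w' - set ?w \<Longrightarrow> \<bar>letter_index (w', \<tau>') Y\<bar> = 1"
    by (rule prescribe_indices[where \<tau> = \<tau> and f = "\<lambda>Y. if Y = X then int k else 0"])
      blast
  have sub: "set ?w \<subseteq> set w'" using fil by (metis filter_is_subset)
  have "filter (\<lambda>Y. int r dvd letter_index (w', \<tau>') Y) w' = filter (\<lambda>Y. Y \<in> set w) w'"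
  proof (rule filter_cong[OF refl])
    fix Y assume Y: "Y \<in> set w'"
    consider "Y \<in> set w" | "Y = X" | "Y \<in> set w' - set ?w" using Y by auto
    then show "int r dvd letter_index (w', \<tau>') Y \<longleftrightarrow> Y \<in> set w"
    proof cases
      \<comment> \<open>The prescribed index is 0, which every \<open>r\<close> divides, including
        \<open>r = 0\<close>.\<close>
      case 1
      then show ?thesis using old[of Y] X by auto
    next
      case 2
      then show ?thesis using old[of Y] X assms(4) by auto
    next
      \<comment> \<open>A pendant letter has index 1 or -1, divisible by \<open>r\<close> only for
        \<open>r = 1\<close>.\<close>
      case 3
      then have "int r dvd letter_index (w', \<tau>') Y \<longleftrightarrow> int r dvd 1"
        using new[of Y] by (metis dvd_abs_iff)
      then show ?thesis using 3 assms(1) by auto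
    qed
  qed
  also have "\<dots> = filter (\<lambda>Y. Y \<in> set w) (filter (\<lambda>Y. Y \<in> set ?w) w')"
    by (auto intro: filter_cong)
  also have "\<dots> = w" unfolding fil using X by simp
  finally have "covering r (w', \<tau>') = (w, \<tau>')" by (simp add: covering_def)
  moreover have "((w, \<tau>'), (w, \<tau>)) \<in> homotopy" using t by (intro homotopy_retype \<alpha>) simp
  moreover have "index_sum (index_test (int m)) (w', \<tau>') = of_bool (m = k)" if "m \<ge> 2" for m
  proof -
    \<comment> \<open>Neither the index 0 of the old letters nor the indices 1 and -1 of the
      pendants equal \<open>m\<close> or \<open>- m\<close> when \<open>m \<ge> 2\<close>. So only
      \<open>X\<close> can contribute, and it does so exactly for \<open>m = k\<close>.\<close>
    have "index_test (int m) (letter_index (w', \<tau>') Y) = (if Y = X then of_bool (m = k) else 0)"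
      if Y: "Y \<in> set w'" for Y
    proof (cases "Y \<in> set ?w")
      case True
      then show ?thesis using old[of Y] \<open>m \<ge> 2\<close> \<open>k \<ge> 2\<close> by (auto simp: index_test_def)
    next
      case False
      then have "Y \<noteq> X" "\<bar>letter_index (w', \<tau>') Y\<bar> = 1" using new[of Y] Y by auto
      then show ?thesis using \<open>m \<ge> 2\<close> by (auto simp: index_test_def)
    qed
    moreover have "X \<in> set w'" using sub by auto
    ultimately show ?thesis by (simp add: index_sum_def)
  qed
  ultimately show ?thesis using that[of "(w', \<tau>')"] g by (simp add: \<alpha> nanowords_def)
qed

lemma infinite_nondivisible:
  fixes r :: nat
  assumes "r \<noteq> 1"
  shows "infinite {k. k \<ge> 2 \<and> \<not> r dvd k}"
  unfolding infinite_nat_iff_unbounded_le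
proof
  fix m :: nat
  show "\<exists>k\<ge>m. k \<in> {k. k \<ge> 2 \<and> \<not> r dvd k}"
  proof (cases "r = 0")
    case True
    \<comment> \<open>Zero divides only zero, so any number from 2 on will do.\<close>
    then show ?thesis by (intro exI[of _ "m + 2"]) auto
  next
    case False
    with assms have r: "r \<ge> 2" by simp
    \<comment> \<open>The witness is one more than a multiple of \<open>r\<close> that exceeds
      \<open>m\<close>.\<close>
    then have "m + 1 \<le> r * (m + 1)" using mult_le_mono1[of 1 r "m + 1"] by simp
    moreover have "\<not> r dvd r * (m + 1) + 1" using assms by (simp only: dvd_add_right_iff dvd_triv_left) simp
    ultimately show ?thesis by (intro exI[of _ "r * (m + 1) + 1"]) auto
  qed
qed

lemma class_in_virtual_strings: "\<alpha> \<in> nanowords \<Longrightarrow> homotopy `` {\<alpha>} \<in> virtual_strings"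
  by (simp add: virtual_strings_def quotientI)

lemma infinite_fibre:
  assumes "r \<noteq> 1" "\<Gamma> \<in> virtual_strings"
  shows "infinite {\<Lambda> \<in> virtual_strings. vs_covering r \<Lambda> = \<Gamma>}"
proof -
  let ?K = "{k. k \<ge> 2 \<and> \<not> r dvd k}"
  obtain \<alpha> where \<alpha>: "\<alpha> \<in> nanowords" "\<Gamma> = homotopy `` {\<alpha>}"
    using assms(2) unfolding virtual_strings_def by (metis quotientE)
  have "\<forall>k\<in>?K. \<exists>\<beta>. \<beta> \<in> nanowords \<and> (covering r \<beta>, \<alpha>) \<in> homotopy \<and>
    (\<forall>m\<ge>2. index_sum (index_test (int m)) \<beta> = of_bool (m = k))"
    using covering_preimage[OF assms(1) \<alpha>(1)] by (metis (mono_tags, lifting) mem_Collect_eq)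
  then obtain \<beta> where \<beta>: "\<forall>k\<in>?K. \<beta> k \<in> nanowords \<and> (covering r (\<beta> k), \<alpha>) \<in> homotopy \<and>
    (\<forall>m\<ge>2. index_sum (index_test (int m)) (\<beta> k) = of_bool (m = k))"
    by (rule bchoice[THEN exE])
  have "inj_on (\<lambda>k. homotopy `` {\<beta> k}) ?K"
  proof (rule inj_onI)
    fix k l assume kl: "k \<in> ?K" "l \<in> ?K" "homotopy `` {\<beta> k} = homotopy `` {\<beta> l}"
    then have "(\<beta> k, \<beta> l) \<in> homotopy"
      using eq_equiv_class[OF _ equiv_homotopy] \<beta> by blast
    \<comment> \<open>The left side is 1, while the right side is 1 only for
      \<open>l = k\<close>.\<close>
    then have "index_sum (index_test (int k)) (\<beta> k) = index_sum (index_test (int k)) (\<beta> l)"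
      by (rule index_sum_homotopy) (rule index_test_minus)
    then show "k = l" using \<beta> kl(1,2) by (simp split: if_splits)
  qed
  then have "infinite ((\<lambda>k. homotopy `` {\<beta> k}) ` ?K)"
    using infinite_nondivisible[OF assms(1)] by (simp add: finite_image_iff)
  moreover have "(\<lambda>k. homotopy `` {\<beta> k}) ` ?K \<subseteq> {\<Lambda> \<in> virtual_strings. vs_covering r \<Lambda> = \<Gamma>}"
  proof (rule image_subsetI)
    fix k assume "k \<in> ?K"
    then have "\<beta> k \<in> nanowords" "(covering r (\<beta> k), \<alpha>) \<in> homotopy" using \<beta> by blast+
    then show "homotopy `` {\<beta> k} \<in> {\<Lambda> \<in> virtual_strings. vs_covering r \<Lambda> = \<Gamma>}"
      by (simp add: vs_covering_class class_in_virtual_strings \<alpha>(2) equiv_class_eq[OF equiv_homotopy])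
  qed
  ultimately show ?thesis using infinite_super by blast
qed

theorem theorem6p2:
  fixes r :: nat
  shows "vs_covering r ` virtual_strings = virtual_strings \<and>
    (r \<noteq> 1 \<longrightarrow>
      (\<forall>\<Gamma>\<in>virtual_strings. infinite {\<Lambda> \<in> virtual_strings. vs_covering r \<Lambda> = \<Gamma>}))"
proof (intro conjI impI ballI equalityI subsetI)
  fix \<Gamma> assume "\<Gamma> \<in> vs_covering r ` virtual_strings"
  then obtain \<alpha> where "\<alpha> \<in> nanowords" "\<Gamma> = vs_covering r (homotopy `` {\<alpha>})"
    unfolding virtual_strings_def by (metis imageE quotientE)
  then show "\<Gamma> \<in> virtual_strings"
    by (simp add: vs_covering_class class_in_virtual_strings covering_nanoword)
next
  fix \<Gamma> assume \<Gamma>: "\<Gamma> \<in> virtual_strings"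
  show "\<Gamma> \<in> vs_covering r ` virtual_strings"
  proof (cases "r = 1")
    case True
    obtain \<alpha> where \<alpha>: "\<alpha> \<in> nanowords" "\<Gamma> = homotopy `` {\<alpha>}"
      using \<Gamma> unfolding virtual_strings_def by (metis quotientE)
    \<comment> \<open>Every index is divisible by 1, so nothing is deleted and the 1-covering is the
      identity.\<close>
    then have "vs_covering r \<Gamma> = \<Gamma>" using True by (simp add: vs_covering_class covering_def)
    then show ?thesis using \<Gamma> by (metis image_eqI)
  next
    case False
    then have "{\<Lambda> \<in> virtual_strings. vs_covering r \<Lambda> = \<Gamma>} \<noteq> {}"
      using \<Gamma> by (intro infinite_imp_nonempty infinite_fibre)
    then show ?thesis by blast
  qed
qed (rule infinite_fibre)

end
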